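(* Let $\delta$ and $\alpha$ be positive real numbers and let $\Delta$ be a positive integer. Let $G$ be an $n$-vertex graph of minimum degree at least $(\delta+\alpha)n$. Then $G$ contains (as a subgraph) every bipartite graph $H$ on at most $\delta n$ vertices with maximum degree at most $\Delta$ and bandwidth at most $\frac{1}{256\Delta}\alpha^{6\Delta+1}n$.
   Context: The bandwidth of an $m$-vertex graph $H$ is the minimum integer $b$ for which there is a labelling of $V(H)$ by $[m]$ (bijectively) such that $|i-j|\le b$ for every edge $\{i,j\}\in E(H)$. *)

theory Defs
  imports "HOL-Analysis.Analysis" "Graph_Theory.Graph_Theory"
begin

text \<open>
  Finite simple graphs are \<open>pair_graph\<close>s: loop-free symmetric digraphs whose arcs are pairs of
  vertices. An edge \<open>{u, v}\<close> is present as the two arcs \<open>(u, v)\<close> and \<open>(v, u)\<close>, so the degree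
  of a vertex is its \<open>out_degree\<close>.
\<close>

definition bipartite :: "'a pair_pre_digraph \<Rightarrow> bool" where
  "bipartite H \<longleftrightarrow> (\<exists>A B. A \<union> B = pverts H \<and> A \<inter> B = {} \<and>
     (\<forall>(u, v) \<in> parcs H. (u \<in> A \<and> v \<in> B) \<or> (u \<in> B \<and> v \<in> A)))"

text \<open>The minimum is over the natural numbers, so an edgeless graph has bandwidth \<open>0\<close>.\<close>

definition bandwidth :: "'a pair_pre_digraph \<Rightarrow> nat" where
  "bandwidth H = (LEAST b. \<exists>f. bij_betw f (pverts H) {1..card (pverts H)} \<and>
     (\<forall>(u, v) \<in> parcs H. \<bar>int (f u) - int (f v)\<bar> \<le> int b))"

definition contains_copy :: "'a pair_pre_digraph \<Rightarrow> 'b pair_pre_digraph \<Rightarrow> bool" where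
  "contains_copy G H \<longleftrightarrow> (\<exists>H'. subgraph H' (with_proj G) \<and> digraph_iso (with_proj H) H')"

lemma contains_copy_iff:
  assumes "pair_graph G" "pair_graph H"
  shows "contains_copy G H \<longleftrightarrow>
    (\<exists>f. inj_on f (pverts H) \<and> f ` pverts H \<subseteq> pverts G \<and>
         (\<forall>(u, v) \<in> parcs H. (f u, f v) \<in> parcs G))" (is "_ \<longleftrightarrow> ?R")
proof
  interpret G: pair_graph G by fact
  interpret H: pair_graph H by fact
  assume "contains_copy G H"
  then obtain h where sub: "subgraph (app_iso h (with_proj H)) (with_proj G)"
    and iso: "pre_digraph.digraph_isomorphism (with_proj H) h"
    unfolding contains_copy_def digraph_iso_def by blast
  have ends: "fst (iso_arcs h a) = iso_verts h (fst a) \<and> snd (iso_arcs h a) = iso_verts h (snd a)"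
    if "a \<in> parcs H" for a
    using that sub iso
    by (auto simp: pre_digraph.digraph_isomorphism_def app_iso_def subgraph_def compatible_def)
  have "(iso_verts h u, iso_verts h v) \<in> parcs G" if "(u, v) \<in> parcs H" for u v
  proof -
    have "iso_arcs h (u, v) \<in> parcs G"
      using that sub by (auto simp: subgraph_def app_iso_def)
    then show ?thesis using ends[OF that] by (metis fst_conv snd_conv prod.collapse)
  qed
  moreover have "inj_on (iso_verts h) (pverts H)" "iso_verts h ` pverts H \<subseteq> pverts G"
    using sub iso by (auto simp: pre_digraph.digraph_isomorphism_def app_iso_def subgraph_def)
  ultimately show ?R by blast
next
  interpret G: pair_graph G by fact
  interpret H: pair_graph H by fact
  assume ?R
  then obtain f where inj: "inj_on f (pverts H)" and im: "f ` pverts H \<subseteq> pverts G"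
    and arc: "\<And>u v. (u, v) \<in> parcs H \<Longrightarrow> (f u, f v) \<in> parcs G" by blast
  define h where "h = \<lparr>iso_verts = f, iso_arcs = map_prod f f,
    iso_head = (snd :: 'a \<times> 'a \<Rightarrow> 'a), iso_tail = (fst :: 'a \<times> 'a \<Rightarrow> 'a)\<rparr>"
  have "inj_on (map_prod f f) (parcs H)"
    using inj by (auto simp: inj_on_def) (meson H.wellformed')+
  then have iso: "pre_digraph.digraph_isomorphism (with_proj H) h"
    using inj H.wf_digraph by (auto simp: pre_digraph.digraph_isomorphism_def h_def)
  have "wf_digraph (app_iso h (with_proj H))"
    using iso by (rule H.wf_digraphI_app_iso)
  then have "subgraph (app_iso h (with_proj H)) (with_proj G)"
    using im arc G.wf_digraph
    by (auto simp: subgraph_def compatible_def app_iso_def h_def with_proj_def)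
  with iso show "contains_copy G H"
    unfolding contains_copy_def digraph_iso_def by blast
qed

end

theory Submission
  imports Defs
begin

text \<open>
  Label the vertices of \<open>H\<close> according to its bandwidth \<open>b\<close>, let \<open>A\<close>, \<open>B\<close> be its colour classes, and
  cut the labelling into blocks of length \<open>2b\<close>. Blocks are embedded one after the other. As at most
  \<open>\<delta>n\<close> vertices are ever used, the set \<open>U\<close> of unused vertices always induces a graph of minimum
  degree at least \<open>\<alpha>n\<close>, so dependent random choice yields a reservoir \<open>C \<subseteq> U\<close>, the common
  neighbourhood of \<open>\<Delta>\<close> random vertices of \<open>U\<close>, in which almost all \<open>\<Delta>\<close>-tuples have many common
  neighbours in \<open>U\<close>. The next reservoir is chosen so that it also meets the current one in a positive
  proportion. The \<open>A\<close>-vertices of block \<open>j\<close> go to \<open>C\<^sub>j \<inter> C\<^sub>j\<^sub>+\<^sub>1\<close>: a vertex of \<open>B\<close> whose neighbours lie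
  in blocks \<open>j - 1\<close> and \<open>j\<close> then has all of them mapped into the single reservoir \<open>C\<^sub>j\<close>. The
  \<open>A\<close>-vertices are placed greedily such that the partial images of the neighbourhoods of \<open>B\<close>-vertices
  have few bad completions, and then the \<open>B\<close>-vertices are placed greedily in common neighbourhoods.
\<close>

section \<open>Common neighbourhoods and bad tuples\<close>

definition common_nbrs :: "('a \<times> 'a) set \<Rightarrow> 'a set \<Rightarrow> 'a set \<Rightarrow> 'a set" where
  "common_nbrs E U Q = {v \<in> U. \<forall>q\<in>Q. (q, v) \<in> E}"

text \<open>Lists rather than sets, as for sampling with replacement: the counts are then exact
  powers.\<close>

definition tuples :: "nat \<Rightarrow> 'a set \<Rightarrow> 'a list set" where
  "tuples k C = {zs. set zs \<subseteq> C \<and> length zs = k}"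

text \<open>A set \<open>Q\<close> still to be enlarged by \<open>k\<close> vertices is kept so that fewer than \<open>r ^ k\<close> of its
  extensions are bad; then fewer than \<open>r\<close> choices of the next vertex violate this for \<open>k - 1\<close>.\<close>

definition bad_extensions ::
  "('a \<times> 'a) set \<Rightarrow> 'a set \<Rightarrow> real \<Rightarrow> 'a set \<Rightarrow> nat \<Rightarrow> 'a set \<Rightarrow> nat" where
  "bad_extensions E U \<theta> C k Q =
     card {zs \<in> tuples k C. real (card (common_nbrs E U (Q \<union> set zs))) < \<theta>}"

lemma common_nbrs_subset: "common_nbrs E U Q \<subseteq> U"
  by (auto simp: common_nbrs_def)

lemma finite_common_nbrs: "finite U \<Longrightarrow> finite (common_nbrs E U Q)"
  using common_nbrs_subset by (rule finite_subset)

lemma common_nbrs_antimono: "Q \<subseteq> R \<Longrightarrow> common_nbrs E U R \<subseteq> common_nbrs E U Q"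
  by (auto simp: common_nbrs_def)

lemma finite_tuples: "finite C \<Longrightarrow> finite (tuples k C)"
  unfolding tuples_def by (rule finite_lists_length_eq)

lemma card_tuples: "finite C \<Longrightarrow> card (tuples k C) = card C ^ k"
  unfolding tuples_def by (rule card_lists_length_eq)

lemma bad_extensions_Suc:
  assumes "finite C"
  shows "bad_extensions E U \<theta> C (Suc k) Q = (\<Sum>z\<in>C. bad_extensions E U \<theta> C k (insert z Q))"
proof -
  let ?T = "\<lambda>z. {zs \<in> tuples k C. real (card (common_nbrs E U (insert z Q \<union> set zs))) < \<theta>}"
  have "{zs \<in> tuples (Suc k) C. real (card (common_nbrs E U (Q \<union> set zs))) < \<theta>}
      = (\<lambda>(z, zs). z # zs) ` (SIGMA z:C. ?T z)"
    by (auto simp: tuples_def length_Suc_conv image_iff Bex_def)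
  moreover have "inj_on (\<lambda>(z, zs). z # zs) (SIGMA z:C. ?T z)"
    by (auto simp: inj_on_def)
  ultimately have "bad_extensions E U \<theta> C (Suc k) Q = card (SIGMA z:C. ?T z)"
    by (simp add: bad_extensions_def card_image)
  then show ?thesis
    using assms by (simp add: bad_extensions_def finite_tuples)
qed

text \<open>Markov's inequality: the counts for the sets \<open>insert z Q\<close> add up to the
  count for \<open>Q\<close>, and each violating \<open>z\<close> contributes at least
  \<open>r ^ k\<close>.\<close>

lemma card_bad_vertices_less:
  assumes "finite C" and "r > 0" and "real (bad_extensions E U \<theta> C (Suc k) Q) < r ^ Suc k"
  shows "real (card {z \<in> C. real (bad_extensions E U \<theta> C k (insert z Q)) \<ge> r ^ k}) < r"
proof -
  let ?Z = "{z \<in> C. real (bad_extensions E U \<theta> C k (insert z Q)) \<ge> r ^ k}"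
  have "real (card ?Z) * r ^ k = (\<Sum>z\<in>?Z. r ^ k)"
    by simp
  also have "\<dots> \<le> (\<Sum>z\<in>?Z. real (bad_extensions E U \<theta> C k (insert z Q)))"
    by (rule sum_mono) simp
  also have "\<dots> \<le> (\<Sum>z\<in>C. real (bad_extensions E U \<theta> C k (insert z Q)))"
    using assms(1) by (intro sum_mono2) auto
  also have "\<dots> < r ^ Suc k"
    using assms by (simp add: bad_extensions_Suc)
  finally show ?thesis
    using assms(2) by simp
qed

text \<open>Enlarging \<open>Q\<close> shrinks its common neighbourhood, so if \<open>Q\<close>
  itself failed, all \<open>card C ^ k\<close> extensions would be bad. Positive \<open>k\<close>
  covers neighbourhoods with fewer than \<Delta> vertices.\<close>

lemma many_common_nbrs:
  assumes "finite U" and "finite C" and "0 < r" and "r < real (card C)"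
    and good: "real (bad_extensions E U \<theta> C k Q) < r ^ k"
  shows "\<theta> \<le> real (card (common_nbrs E U Q))"
proof (rule ccontr)
  assume neg: "\<not> ?thesis"
  have "real (card (common_nbrs E U (Q \<union> set zs))) < \<theta>" for zs
    using neg card_mono[OF finite_common_nbrs[OF assms(1)] common_nbrs_antimono[of Q "Q \<union> set zs"]]
    by (smt (verit) Un_upper1 of_nat_mono)
  then have "bad_extensions E U \<theta> C k Q = card C ^ k"
    using assms(2) by (simp add: bad_extensions_def card_tuples)
  moreover have "r ^ k \<le> real (card C) ^ k"
    using assms by (intro power_mono) auto
  ultimately show False
    using good by simp
qed

section \<open>Dependent random choice\<close>

text \<open>Jensen's inequality with equal weights for the power function, which is convex on the
  nonnegative reals.\<close>

lemma sum_power_ge: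
  fixes x :: "'i \<Rightarrow> real"
  assumes "finite I" and "I \<noteq> {}" and "\<And>i. i \<in> I \<Longrightarrow> 0 \<le> x i"
  shows "real (card I) * ((\<Sum>i\<in>I. x i) / real (card I)) ^ s \<le> (\<Sum>i\<in>I. x i ^ s)"
proof -
  have pos: "real (card I) > 0"
    using assms by (simp add: card_gt_0_iff)
  have "convex_on {0..} (\<lambda>t::real. t ^ s)"
    by (cases "even s") (auto intro: convex_power_odd convex_on_subset[OF convex_power_even])
  then have "(\<Sum>i\<in>I. (1 / real (card I)) *\<^sub>R x i) ^ s \<le> (\<Sum>i\<in>I. 1 / real (card I) * x i ^ s)"
    using assms pos by (intro convex_on_sum) auto
  then show ?thesis
    using pos by (simp add: sum_divide_distrib[symmetric] field_simps)
qed

text \<open>Dependent random choice: \<open>C\<close> is the common neighbourhood of \<open>s\<close> uniformly random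
  vertices of \<open>U\<close>. Bounding the product of the sizes of \<open>C \<inter> W\<close> and \<open>C\<close> from below in expectation
  gives both lower bounds for the same choice.\<close>

lemma dependent_random_choice:
  assumes "finite U" and "sym E" and "W \<subseteq> U" and "W \<noteq> {}" and "0 < d" and "0 < \<theta>" and "0 < s"
    and deg: "\<And>u. u \<in> U \<Longrightarrow> d \<le> real (card (common_nbrs E U {u}))"
  obtains C where "C \<subseteq> U"
    and "(d / real (card U)) ^ (2 * s) / 2 * real (card W) \<le> real (card (C \<inter> W))"
    and "(d / real (card U)) ^ (2 * s) / 2 * real (card U) \<le> real (card C)"
    and "real (bad_extensions E U \<theta> C s {}) < (2 * \<theta> * (real (card U))\<^sup>2 / d\<^sup>2) ^ s"
proof -
  define N where "N = real (card U)"
  define C where "C = (\<lambda>S. common_nbrs E U (set S))"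
  define T where "T = tuples s U"
  \<comment> \<open>\<open>p\<close> will bound the average of the product of the two sizes over
    \<open>S\<close> from below. The average number of bad tuples is at most
    \<open>\<theta> ^ s\<close>, and \<open>F\<close> exceeds this by the factor
    \<open>2 ^ s / (d / N) ^ (2 * s)\<close>.\<close>
  define p where "p = real (card W) * N * (d / N) ^ (2 * s)"
  define F where "F = (2 * \<theta> * N\<^sup>2 / d\<^sup>2) ^ s"
  have finW: "finite W" using assms finite_subset by blast
  have finT: "finite T" using assms by (simp add: T_def finite_tuples)
  have W0: "card W > 0" using finW assms by (simp add: card_gt_0_iff)
  have "U \<noteq> {}" using assms by auto
  then have N0: "N > 0" using assms by (simp add: N_def card_gt_0_iff)
  have cT: "real (card T) = N ^ s" using assms by (simp add: T_def card_tuples N_def)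
  have symE: "(u, v) \<in> E \<longleftrightarrow> (v, u) \<in> E" for u v using assms(2) by (auto dest: symD)
  have C_conv: "v \<in> C S \<longleftrightarrow> v \<in> U \<and> (\<forall>q\<in>set S. (v, q) \<in> E)" for v S
    using symE by (auto simp: C_def common_nbrs_def)
  have p0: "p > 0" using W0 N0 assms by (simp add: p_def)
  have F0: "F > 0" using N0 assms by (simp add: F_def)

  \<comment> \<open>Double counting through the common neighbour \<open>v\<close>: the sum is that
    of the products of the degrees of \<open>v\<close> into \<open>W\<close> and \<open>U\<close>.
    The second factor is at least \<open>d\<close>, and the first ones add up to the degrees of the
    vertices of \<open>W\<close>.\<close>
  have codeg: "(\<Sum>(u, w)\<in>W \<times> U. real (card (common_nbrs E U {u, w}))) \<ge> d\<^sup>2 * real (card W)"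
  proof -
    have ind: "real (card (common_nbrs E X {v})) = (\<Sum>x\<in>X. of_bool ((v, x) \<in> E))"
      if "finite X" for X v
      using that by (simp add: common_nbrs_def sum.If_cases of_bool_def Int_def)
    have "(\<Sum>(u, w)\<in>W \<times> U. real (card (common_nbrs E U {u, w})))
        = (\<Sum>(u, w)\<in>W \<times> U. \<Sum>v\<in>U. of_bool ((u, v) \<in> E \<and> (w, v) \<in> E))"
      using assms(1)
      by (intro sum.cong refl) (auto simp: common_nbrs_def sum.If_cases of_bool_def Int_def)
    also have "\<dots> = (\<Sum>v\<in>U. \<Sum>(u, w)\<in>W \<times> U. of_bool ((v, u) \<in> E) * of_bool ((v, w) \<in> E))"
      unfolding case_prod_unfold by (subst sum.swap) (simp add: symE of_bool_conj)
    also have "\<dots> = (\<Sum>v\<in>U. (\<Sum>u\<in>W. of_bool ((v, u) \<in> E)) * (\<Sum>w\<in>U. of_bool ((v, w) \<in> E)))"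
      by (rule sum.cong[OF refl]) (simp add: sum_product sum.cartesian_product)
    also have "\<dots> = (\<Sum>v\<in>U. real (card (common_nbrs E W {v})) * real (card (common_nbrs E U {v})))"
      using assms(1) finW by (simp only: ind)
    also have "\<dots> \<ge> (\<Sum>v\<in>U. real (card (common_nbrs E W {v})) * d)"
      by (intro sum_mono mult_left_mono deg) auto
    also have "(\<Sum>v\<in>U. real (card (common_nbrs E W {v})) * d)
        = d * (\<Sum>v\<in>U. \<Sum>u\<in>W. of_bool ((v, u) \<in> E))"
      using finW by (simp add: ind sum_distrib_left mult.commute)
    also have "(\<Sum>v\<in>U. \<Sum>u\<in>W. of_bool ((v, u) \<in> E)) = (\<Sum>u\<in>W. real (card (common_nbrs E U {u})))"
      by (subst sum.swap) (simp add: ind assms(1) symE)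
    finally have "d * (\<Sum>u\<in>W. real (card (common_nbrs E U {u})))
        \<le> (\<Sum>(u, w)\<in>W \<times> U. real (card (common_nbrs E U {u, w})))" .
    moreover have "(\<Sum>u\<in>W. real (card (common_nbrs E U {u}))) \<ge> (\<Sum>u\<in>W. d)"
      using assms by (intro sum_mono deg) auto
    ultimately show ?thesis
      using \<open>0 < d\<close> by (simp add: power2_eq_square mult_ac) (smt (verit) mult_left_mono)
  qed

  \<comment> \<open>\<open>u\<close> and \<open>w\<close> both lie in \<open>C S\<close> exactly
    when \<open>S\<close> is drawn from their common neighbourhood; Jensen then reduces the
    \<open>s\<close>-th powers to the average from \<open>codeg\<close>.\<close>
  have sumP: "(\<Sum>S\<in>T. real (card (C S \<inter> W)) * real (card (C S))) \<ge> N ^ s * p"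
  proof -
    have "(\<Sum>S\<in>T. real (card (C S \<inter> W)) * real (card (C S)))
        = (\<Sum>S\<in>T. \<Sum>(u, w)\<in>W \<times> U. of_bool (u \<in> C S \<and> w \<in> C S))"
    proof (rule sum.cong[OF refl])
      fix S
      have "real (card (C S \<inter> W)) = (\<Sum>u\<in>W. of_bool (u \<in> C S))"
        using finW by (simp add: of_bool_def sum.If_cases Int_commute)
      moreover have "C S \<subseteq> U" by (simp add: C_def common_nbrs_subset)
      then have "real (card (C S)) = (\<Sum>u\<in>U. of_bool (u \<in> C S))"
        using assms(1) by (simp add: of_bool_def sum.If_cases Int_absorb1)
      ultimately show "real (card (C S \<inter> W)) * real (card (C S))
          = (\<Sum>(u, w)\<in>W \<times> U. of_bool (u \<in> C S \<and> w \<in> C S))"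
        by (simp add: sum_product sum.cartesian_product of_bool_conj)
    qed
    also have "\<dots> = (\<Sum>(u, w)\<in>W \<times> U. \<Sum>S\<in>T. of_bool (u \<in> C S \<and> w \<in> C S))"
      by (subst sum.swap) (simp add: case_prod_unfold)
    also have "\<dots> = (\<Sum>(u, w)\<in>W \<times> U. real (card (common_nbrs E U {u, w})) ^ s)"
    proof (intro sum.cong refl, clarify)
      fix u w assume "u \<in> W" "w \<in> U"
      then have "{S \<in> T. u \<in> C S \<and> w \<in> C S} = tuples s (common_nbrs E U {u, w})"
        using assms(3) by (auto simp: T_def tuples_def C_conv common_nbrs_def)
      then show "(\<Sum>S\<in>T. of_bool (u \<in> C S \<and> w \<in> C S))
          = real (card (common_nbrs E U {u, w})) ^ s"
        using finT assms(1)
        by (simp add: of_bool_def sum.If_cases Int_def card_tuples finite_common_nbrs)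
    qed
    also have "\<dots> \<ge> real (card (W \<times> U)) * ((\<Sum>(u, w)\<in>W \<times> U. real (card (common_nbrs E U {u, w})))
        / real (card (W \<times> U))) ^ s"
      using sum_power_ge[of "W \<times> U" "\<lambda>(u, w). real (card (common_nbrs E U {u, w}))" s]
        finW assms \<open>U \<noteq> {}\<close> by (simp add: case_prod_unfold)
    also have "real (card (W \<times> U)) * ((\<Sum>(u, w)\<in>W \<times> U. real (card (common_nbrs E U {u, w})))
        / real (card (W \<times> U))) ^ s \<ge> real (card W) * N * (d\<^sup>2 / N) ^ s"
    proof -
      have "d\<^sup>2 / N \<le> (\<Sum>(u, w)\<in>W \<times> U. real (card (common_nbrs E U {u, w}))) / real (card (W \<times> U))"
        using codeg W0 N0 by (simp add: N_def card_cartesian_product field_simps)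
      then show ?thesis
        using N0 by (simp add: N_def card_cartesian_product mult_left_mono power_mono)
    qed
    also have "real (card W) * N * (d\<^sup>2 / N) ^ s = N ^ s * p"
    proof -
      have "d\<^sup>2 / N = N * (d / N)\<^sup>2"
        using N0 by (simp add: power2_eq_square)
      then have "(d\<^sup>2 / N) ^ s = N ^ s * (d / N) ^ (2 * s)"
        by (simp only: power_mult_distrib power_mult)
      then show ?thesis by (simp add: p_def)
    qed
    finally show ?thesis by simp
  qed

  \<comment> \<open>A bad \<open>Q\<close> lies inside \<open>C S\<close> exactly when
    \<open>S\<close> is drawn from the fewer than \<theta> common neighbours of \<open>Q\<close>.
    Tuples and samples both have length \<open>s\<close>, so at most \<open>N ^ s\<close> tuples are
    bad.\<close>
  have sumF: "(\<Sum>S\<in>T. real (bad_extensions E U \<theta> (C S) s {})) \<le> N ^ s * \<theta> ^ s"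
  proof -
    define Bd where "Bd = {Q \<in> T. real (card (common_nbrs E U (set Q))) < \<theta>}"
    have finB: "finite Bd" using finT by (simp add: Bd_def)
    have "(\<Sum>S\<in>T. real (bad_extensions E U \<theta> (C S) s {}))
        = (\<Sum>S\<in>T. \<Sum>Q\<in>Bd. of_bool (set Q \<subseteq> C S))"
    proof (rule sum.cong[OF refl])
      fix S
      have "{zs \<in> tuples s (C S). real (card (common_nbrs E U ({} \<union> set zs))) < \<theta>}
          = {Q \<in> Bd. set Q \<subseteq> C S}"
        by (auto simp: Bd_def T_def tuples_def C_conv)
      then show "real (bad_extensions E U \<theta> (C S) s {}) = (\<Sum>Q\<in>Bd. of_bool (set Q \<subseteq> C S))"
        using finB by (simp add: bad_extensions_def of_bool_def sum.If_cases Int_def)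
    qed
    also have "\<dots> = (\<Sum>Q\<in>Bd. \<Sum>S\<in>T. of_bool (set Q \<subseteq> C S))"
      by (rule sum.swap)
    also have "\<dots> = (\<Sum>Q\<in>Bd. real (card (common_nbrs E U (set Q))) ^ s)"
    proof (rule sum.cong[OF refl])
      fix Q assume "Q \<in> Bd"
      then have "{S \<in> T. set Q \<subseteq> C S} = tuples s (common_nbrs E U (set Q))"
        by (auto simp: Bd_def T_def tuples_def C_conv common_nbrs_def subset_iff)
      then show "(\<Sum>S\<in>T. of_bool (set Q \<subseteq> C S)) = real (card (common_nbrs E U (set Q))) ^ s"
        using finT assms(1)
        by (simp add: of_bool_def sum.If_cases Int_def card_tuples finite_common_nbrs)
    qed
    also have "\<dots> \<le> (\<Sum>Q\<in>Bd. \<theta> ^ s)"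
      by (intro sum_mono power_mono) (auto simp: Bd_def)
    also have "\<dots> \<le> real (card T) * \<theta> ^ s"
      using card_mono[OF finT, of Bd] assms by (auto simp: Bd_def intro!: mult_right_mono)
    finally show ?thesis by (simp add: cT)
  qed

  have PU: "real (card (C S \<inter> W)) \<le> real (card W)" "real (card (C S)) \<le> N" for S
    using assms(1) finW by (auto simp: N_def C_def common_nbrs_def intro!: card_mono)

  have "\<exists>S\<in>T. p / 2 \<le> real (card (C S \<inter> W)) * real (card (C S)) \<and>
      real (bad_extensions E U \<theta> (C S) s {}) < F"
  proof (rule ccontr)
    assume neg: "\<not> ?thesis"
    \<comment> \<open>The product never exceeds \<open>card W * N\<close>, so an \<open>S\<close>
      with at least \<open>F\<close> bad tuples is paid for by them at the price
      \<open>card W * N / F\<close> each.\<close>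
    have "real (card (C S \<inter> W)) * real (card (C S))
        < p / 2 + real (bad_extensions E U \<theta> (C S) s {}) * (real (card W) * N / F)"
      if "S \<in> T" for S
    proof (cases "p / 2 \<le> real (card (C S \<inter> W)) * real (card (C S))")
      case True
      with neg that have "F \<le> real (bad_extensions E U \<theta> (C S) s {})" by force
      then have "real (card W) * N \<le> real (bad_extensions E U \<theta> (C S) s {}) * (real (card W) * N / F)"
        using F0 N0 W0 by (simp add: field_simps)
      moreover have "real (card (C S \<inter> W)) * real (card (C S)) \<le> real (card W) * N"
        using PU by (intro mult_mono) auto
      ultimately show ?thesis using p0 by linarith
    next
      case False
      moreover have "0 \<le> real (bad_extensions E U \<theta> (C S) s {}) * (real (card W) * N / F)"
        using F0 N0 by simp
      ultimately show ?thesis by linarith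
    qed
    moreover have "T \<noteq> {}" using cT N0 by auto
    ultimately have "(\<Sum>S\<in>T. real (card (C S \<inter> W)) * real (card (C S)))
        < (\<Sum>S\<in>T. p / 2 + real (bad_extensions E U \<theta> (C S) s {}) * (real (card W) * N / F))"
      using finT by (intro sum_strict_mono) auto
    also have "\<dots> = N ^ s * (p / 2)
        + (\<Sum>S\<in>T. real (bad_extensions E U \<theta> (C S) s {})) * (real (card W) * N / F)"
      by (simp add: sum.distrib cT sum_distrib_right sum_divide_distrib)
    also have "\<dots> \<le> N ^ s * (p / 2) + (N ^ s * \<theta> ^ s) * (real (card W) * N / F)"
      using sumF F0 N0 by (intro add_left_mono mult_right_mono) auto
    also have "(N ^ s * \<theta> ^ s) * (real (card W) * N / F) = N ^ s * (p / 2 ^ s)"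
    proof -
      have "\<theta> / (2 * \<theta> * N\<^sup>2 / d\<^sup>2) = (d / N)\<^sup>2 / 2"
        using \<open>0 < \<theta>\<close> by (simp add: power_divide)
      then have "\<theta> ^ s / F = (d / N) ^ (2 * s) / 2 ^ s"
        unfolding F_def power_divide[of \<theta>, symmetric] power_mult power_divide[of "(d / N)\<^sup>2", symmetric]
        by (simp only:)
      moreover have "(N ^ s * \<theta> ^ s) * (real (card W) * N / F) = N ^ s * (real (card W) * N * (\<theta> ^ s / F))"
        by simp
      ultimately show ?thesis by (simp add: p_def)
    qed
    \<comment> \<open>Since \<open>s\<close> is at least 1, the two contributions together do not
      exceed the average \<open>p\<close>.\<close>
    also have "\<dots> \<le> N ^ s * (p / 2)"
    proof -
      have "(2::real) ^ 1 \<le> 2 ^ s" using assms by (intro power_increasing) auto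
      then show ?thesis using p0 N0 by (intro mult_left_mono divide_left_mono) auto
    qed
    finally show False using sumP by (simp add: field_simps)
  qed
  then obtain S where S: "p / 2 \<le> real (card (C S \<inter> W)) * real (card (C S))"
    "real (bad_extensions E U \<theta> (C S) s {}) < F" by blast
  \<comment> \<open>Bounding one factor of the product by its maximum leaves the wanted lower bound
    for the other.\<close>
  have "p / 2 \<le> real (card (C S \<inter> W)) * N"
    using S(1) PU(2)[of S] by (smt (verit) mult_left_mono of_nat_0_le_iff)
  then have 1: "(d / N) ^ (2 * s) / 2 * real (card W) \<le> real (card (C S \<inter> W))"
    using N0 by (simp add: p_def field_simps)
  have "p / 2 \<le> real (card W) * real (card (C S))"
    using S(1) PU(1)[of S] by (smt (verit) mult_right_mono of_nat_0_le_iff)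
  then have "real (card W) * ((d / N) ^ (2 * s) / 2 * N) \<le> real (card W) * real (card (C S))"
    by (simp add: p_def mult_ac)
  then have 2: "(d / N) ^ (2 * s) / 2 * N \<le> real (card (C S))"
    using W0 by (simp only: mult_le_cancel_left_pos of_nat_0_less_iff)
  show thesis
    using that[of "C S"] 1 2 S(2) by (simp add: N_def F_def C_def common_nbrs_subset)
qed

section \<open>Greedy placement of vertices\<close>

lemma card_subset_Un_le:
  assumes "C \<subseteq> A \<union> B" and "finite A" and "finite B"
  shows "card C \<le> card A + card B"
  using card_mono[OF finite_UnI[OF assms(2,3)] assms(1)] card_Un_le[of A B] by linarith

text \<open>A new vertex \<open>x\<close> matters to at most \<Delta> vertices \<open>y\<close>,
  each forbidding fewer than \<open>r\<close> images by \<open>card_bad_vertices_less\<close>; fewer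
  than \<open>card D1\<close> points of \<open>X\<close> are occupied. The reservoir depends on
  \<open>y\<close> because two consecutive blocks are tracked at once.\<close>

lemma greedy_embedding_good:
  fixes g :: "'b \<Rightarrow> 'a" and Uy Cy :: "'b \<Rightarrow> 'a set" and N :: "'b \<Rightarrow> 'b set"
  assumes "finite D1" and "finite D0" and "D0 \<inter> D1 = {}" and "finite X" and "finite Y" and "0 < r"
    and inj: "inj_on g D0" and disj: "X \<inter> g ` D0 = {}"
    and N: "\<And>y. y \<in> Y \<Longrightarrow> finite (N y) \<and> card (N y) \<le> \<Delta>"
    and deg: "\<And>x. x \<in> D1 \<Longrightarrow> card {y \<in> Y. x \<in> N y} \<le> \<Delta>"
    and X: "\<And>x y. x \<in> D1 \<Longrightarrow> y \<in> Y \<Longrightarrow> x \<in> N y \<Longrightarrow> X \<subseteq> Cy y"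
    and fin: "\<And>y. y \<in> Y \<Longrightarrow> finite (Cy y)"
    and good: "\<And>y. y \<in> Y \<Longrightarrow> real (bad_extensions E (Uy y) \<theta> (Cy y)
                 (\<Delta> - card (N y \<inter> D0)) (g ` (N y \<inter> D0))) < r ^ (\<Delta> - card (N y \<inter> D0))"
    and big: "real (card D1) + real \<Delta> * r \<le> real (card X)"
  obtains g' where "\<And>x. x \<in> D0 \<Longrightarrow> g' x = g x" and "inj_on g' (D0 \<union> D1)" and "g' ` D1 \<subseteq> X"
    and "\<And>y. y \<in> Y \<Longrightarrow> real (bad_extensions E (Uy y) \<theta> (Cy y)
           (\<Delta> - card (N y \<inter> (D0 \<union> D1))) (g' ` (N y \<inter> (D0 \<union> D1)))) < r ^ (\<Delta> - card (N y \<inter> (D0 \<union> D1)))"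
proof -
  define Good where "Good = (\<lambda>h D y. real (bad_extensions E (Uy y) \<theta> (Cy y)
      (\<Delta> - card (N y \<inter> D)) (h ` (N y \<inter> D))) < r ^ (\<Delta> - card (N y \<inter> D)))"
  have "\<exists>h. (\<forall>x\<in>D0. h x = g x) \<and> inj_on h (D0 \<union> D) \<and> h ` D \<subseteq> X \<and> (\<forall>y\<in>Y. Good h (D0 \<union> D) y)"
    if "finite D" "D \<subseteq> D1" for D
    using that
  proof (induction D rule: finite_induct)
    case empty
    show ?case
      by (rule exI[of _ g]) (use inj good in \<open>auto simp: Good_def\<close>)
  next
    case (insert x D)
    then obtain h where h: "\<forall>x\<in>D0. h x = g x" "inj_on h (D0 \<union> D)" "h ` D \<subseteq> X"
      "\<And>y. y \<in> Y \<Longrightarrow> Good h (D0 \<union> D) y" by auto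
    define Yx where "Yx = {y \<in> Y. x \<in> N y}"
    define Z where "Z = (\<lambda>y. {z \<in> Cy y. r ^ (\<Delta> - Suc (card (N y \<inter> (D0 \<union> D))))
      \<le> real (bad_extensions E (Uy y) \<theta> (Cy y) (\<Delta> - Suc (card (N y \<inter> (D0 \<union> D))))
          (insert z (h ` (N y \<inter> (D0 \<union> D)))))})"
    have xD: "x \<in> D1" "x \<notin> D0 \<union> D" using insert assms(3) by auto
    have finYx: "finite Yx" using assms by (simp add: Yx_def)
    \<comment> \<open>As \<open>x\<close> is a neighbour of \<open>y\<close> not yet placed, the
      exponent is a genuine successor and not a truncated difference.\<close>
    have lt: "card (N y \<inter> (D0 \<union> D)) < \<Delta>" if "y \<in> Yx" for y
    proof -
      have "N y \<inter> (D0 \<union> D) \<subset> N y" using that xD by (auto simp: Yx_def)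
      then have "card (N y \<inter> (D0 \<union> D)) < card (N y)"
        using N that by (intro psubset_card_mono) (auto simp: Yx_def)
      then show ?thesis using N that by (fastforce simp: Yx_def)
    qed
    have Z: "real (card (Z y)) < r" if "y \<in> Yx" for y
      unfolding Z_def
      using that h(4)[of y] fin[of y] \<open>0 < r\<close> lt[OF that]
      by (intro card_bad_vertices_less) (auto simp: Good_def Yx_def Suc_diff_Suc)
    have "real (card (\<Union>y\<in>Yx. Z y)) \<le> (\<Sum>y\<in>Yx. real (card (Z y)))"
      using card_UN_le[OF finYx, of Z] by (metis of_nat_mono of_nat_sum)
    also have "\<dots> \<le> (\<Sum>y\<in>Yx. r)"
      using Z by (intro sum_mono) (auto intro: less_imp_le)
    also have "\<dots> \<le> real \<Delta> * r"
      using deg[OF xD(1)] \<open>0 < r\<close> by (simp add: Yx_def)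
    finally have Zs: "real (card (\<Union>y\<in>Yx. Z y)) \<le> real \<Delta> * r" .
    have "card (h ` D) < card D1"
    proof -
      have "D \<subset> D1" using insert by auto
      then show ?thesis
        using psubset_card_mono[OF assms(1), of D] card_image_le[OF insert(1), of h] by linarith
    qed
    moreover have "card (h ` D \<union> (\<Union>y\<in>Yx. Z y)) \<le> card (h ` D) + card (\<Union>y\<in>Yx. Z y)"
      by (rule card_Un_le)
    ultimately have "real (card (h ` D \<union> (\<Union>y\<in>Yx. Z y))) < real (card X)"
      using Zs big by linarith
    moreover have "finite (h ` D \<union> (\<Union>y\<in>Yx. Z y))"
      using insert(1) finYx fin by (auto simp: Z_def Yx_def)
    ultimately have "\<not> X \<subseteq> h ` D \<union> (\<Union>y\<in>Yx. Z y)"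
      by (metis card_mono linorder_not_le of_nat_mono)
    then obtain z where z: "z \<in> X" "z \<notin> h ` D" "\<And>y. y \<in> Yx \<Longrightarrow> z \<notin> Z y" by blast
    define h' where "h' = h(x := z)"
    have eq: "h' w = h w" if "w \<in> D0 \<union> D" for w using that xD by (auto simp: h'_def)
    have "h ` D0 = g ` D0" using h(1) by auto
    then have "z \<notin> h ` (D0 \<union> D)" using z(1,2) disj by (auto simp: image_Un)
    then have "inj_on h' (insert x (D0 \<union> D))"
      using h(2) xD by (auto simp: inj_on_def h'_def)
    moreover have "Good h' (insert x (D0 \<union> D)) y" if "y \<in> Y" for y
    proof (cases "y \<in> Yx")
      case True
      then have *: "N y \<inter> insert x (D0 \<union> D) = insert x (N y \<inter> (D0 \<union> D))" by (auto simp: Yx_def)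
      have "finite (N y \<inter> (D0 \<union> D))" using N that by auto
      then have **: "card (insert x (N y \<inter> (D0 \<union> D))) = Suc (card (N y \<inter> (D0 \<union> D)))"
        using xD by simp
      have ***: "h' ` insert x (N y \<inter> (D0 \<union> D)) = insert z (h ` (N y \<inter> (D0 \<union> D)))"
      proof -
        have "h' x = z" by (simp add: h'_def)
        moreover have "h' ` (N y \<inter> (D0 \<union> D)) = h ` (N y \<inter> (D0 \<union> D))"
          using eq by (intro image_cong) auto
        ultimately show ?thesis by (simp only: image_insert)
      qed
      have "z \<in> Cy y" using X[OF xD(1) that] True z(1) by (auto simp: Yx_def)
      then show ?thesis
        using z(3)[OF True] unfolding Good_def * ** *** by (auto simp: Z_def)
    next
      case False
      then have *: "N y \<inter> insert x (D0 \<union> D) = N y \<inter> (D0 \<union> D)" using that by (auto simp: Yx_def)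
      have **: "h' ` (N y \<inter> (D0 \<union> D)) = h ` (N y \<inter> (D0 \<union> D))" using eq by (intro image_cong) auto
      show ?thesis using h(4)[OF that] unfolding Good_def * ** .
    qed
    moreover have "h' ` insert x D \<subseteq> X" "\<forall>w\<in>D0. h' w = g w"
      using eq z(1) h by (auto simp: h'_def)
    ultimately show ?case by (intro exI[of _ h']) simp
  qed
  from this[OF assms(1) subset_refl] obtain h where h: "\<forall>x\<in>D0. h x = g x" "inj_on h (D0 \<union> D1)"
    "h ` D1 \<subseteq> X" "\<forall>y\<in>Y. Good h (D0 \<union> D1) y"
    by (elim exE conjE)
  show thesis
    by (rule that[OF bspec[OF h(1)] h(2,3) bspec[OF h(4)[unfolded Good_def]]])
qed

text \<open>All neighbours of \<open>D1\<close> lie in \<open>D0\<close>, so the target sets are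
  fixed in advance; they lose only the used points of \<open>U\<close> and fewer than
  \<open>card D1\<close> new images.\<close>

lemma greedy_embedding_common_nbrs:
  fixes g :: "'b \<Rightarrow> 'a" and N :: "'b \<Rightarrow> 'b set"
  assumes "finite D1" and "finite D0" and "D0 \<inter> D1 = {}" and "finite U"
    and inj: "inj_on g D0"
    and N: "\<And>y. y \<in> D1 \<Longrightarrow> N y \<subseteq> D0"
    and big: "\<And>y. y \<in> D1 \<Longrightarrow> card (U \<inter> g ` D0) + card D1 \<le> card (common_nbrs E U (g ` N y))"
  obtains g' where "\<And>x. x \<in> D0 \<Longrightarrow> g' x = g x" and "inj_on g' (D0 \<union> D1)" and "g' ` D1 \<subseteq> U"
    and "\<And>x y. y \<in> D1 \<Longrightarrow> x \<in> N y \<Longrightarrow> (g' x, g' y) \<in> E"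
proof -
  have "\<exists>h. (\<forall>x\<in>D0. h x = g x) \<and> inj_on h (D0 \<union> D) \<and> h ` D \<subseteq> U \<and>
      (\<forall>y\<in>D. \<forall>x\<in>N y. (h x, h y) \<in> E)" if "finite D" "D \<subseteq> D1" for D
    using that
  proof (induction D rule: finite_induct)
    case empty
    show ?case by (rule exI[of _ g]) (use inj in auto)
  next
    case (insert x D)
    then obtain h where h: "\<forall>x\<in>D0. h x = g x" "inj_on h (D0 \<union> D)" "h ` D \<subseteq> U"
      "\<forall>y\<in>D. \<forall>x\<in>N y. (h x, h y) \<in> E" by auto
    have xD: "x \<in> D1" "x \<notin> D0 \<union> D" using insert assms(3) by auto
    have "D \<subset> D1" using insert by auto
    then have "card (h ` D) < card D1"
      using psubset_card_mono[OF assms(1), of D] card_image_le[OF insert(1), of h] by linarith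
    then have "card ((U \<inter> g ` D0) \<union> h ` D) < card (common_nbrs E U (g ` N x))"
      using big[OF xD(1)] card_Un_le[of "U \<inter> g ` D0" "h ` D"] by linarith
    then have "\<not> common_nbrs E U (g ` N x) \<subseteq> (U \<inter> g ` D0) \<union> h ` D"
      using card_mono[of "(U \<inter> g ` D0) \<union> h ` D" "common_nbrs E U (g ` N x)"] assms(2) insert(1)
      by (auto simp: linorder_not_le[symmetric])
    then obtain z where z: "z \<in> U" "z \<notin> g ` D0" "z \<notin> h ` D" "\<forall>q\<in>N x. (g q, z) \<in> E"
      by (auto simp: common_nbrs_def)
    define h' where "h' = h(x := z)"
    have eq: "h' w = h w" if "w \<in> D0 \<union> D" for w using that xD by (auto simp: h'_def)
    have "h ` D0 = g ` D0" using h(1) by auto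
    then have "z \<notin> h ` (D0 \<union> D)" using z by auto
    then have "inj_on h' (insert x (D0 \<union> D))"
      using h(2) xD by (auto simp: inj_on_def h'_def)
    moreover have "h' ` insert x D \<subseteq> U" "\<forall>w\<in>D0. h' w = g w"
      using eq z(1) h by (auto simp: h'_def)
    moreover have "(h' w, h' y) \<in> E" if "y \<in> insert x D" "w \<in> N y" for y w
    proof -
      have "w \<in> D0" using that N insert.prems by auto
      then have "h' w = h w" "h w = g w" using eq h by auto
      moreover have "(h w, h y) \<in> E \<and> h' y = h y" if "y \<in> D" using that h(4) \<open>w \<in> N y\<close> eq by auto
      ultimately show ?thesis using that z(4) by (auto simp: h'_def)
    qed
    ultimately show ?case by (intro exI[of _ h']) simp
  qed
  from this[OF assms(1) subset_refl] obtain h where h: "\<forall>x\<in>D0. h x = g x" "inj_on h (D0 \<union> D1)"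
    "h ` D1 \<subseteq> U" "\<forall>y\<in>D1. \<forall>x\<in>N y. (h x, h y) \<in> E"
    by (elim exE conjE)
  show thesis
    by (rule that[OF bspec[OF h(1)] h(2,3) bspec[OF bspec[OF h(4)]]])
qed

section \<open>Block-by-block embedding: setting and constants\<close>

locale block_embedding =
  fixes V :: "'a set" and E :: "('a \<times> 'a) set" and A B :: "'b set" and N :: "'b \<Rightarrow> 'b set"
    and lev :: "'b \<Rightarrow> nat" and \<Delta> M :: nat and \<alpha> :: real
  assumes finV: "finite V" and symE: "sym E" and finA: "finite A" and finB: "finite B"
    and AB: "A \<inter> B = {}" and \<alpha>0: "0 < \<alpha>" and \<Delta>0: "0 < \<Delta>" and M0: "0 < M"
    and min_degree: "v \<in> V \<Longrightarrow>
      \<alpha> * real (card V) + real (card A + card B) \<le> real (card (common_nbrs E V {v}))"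
    and N_subset: "y \<in> B \<Longrightarrow> N y \<subseteq> A"
    and card_N: "y \<in> B \<Longrightarrow> card (N y) \<le> \<Delta>"
    and card_N_conv: "x \<in> A \<Longrightarrow> card {y \<in> B. x \<in> N y} \<le> \<Delta>"
    and lev_N: "y \<in> B \<Longrightarrow> x \<in> N y \<Longrightarrow> lev x = lev y \<or> Suc (lev x) = lev y"
    and card_A_level: "card {x \<in> A. lev x = j} \<le> M"
    and card_B_level: "card {y \<in> B. lev y = j} \<le> M"
    and M_le: "128 * real \<Delta> * real M \<le> \<alpha> ^ (6 * \<Delta> + 1) * real (card V)"
begin

definition below :: "nat \<Rightarrow> 'b set" where
  "below j = {x \<in> A \<union> B. lev x < j}"

text \<open>Room for a vertex of \<open>B\<close>: \<open>2 * M\<close> points for the preceding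
  block and \<open>M\<close> for each colour class of the current one.\<close>

definition \<theta> :: real where "\<theta> = 4 * real M"

definition \<xi> :: real where "\<xi> = \<alpha> ^ (4 * \<Delta> + 1) * real (card V) / 8"

text \<open>The images forbidden by \<Delta> neighbours fill at most half of \<xi>; the other half
  is left for the current block.\<close>

definition r :: real where "r = \<xi> / (2 * real \<Delta>)"

definition good :: "'a set \<Rightarrow> 'a set \<Rightarrow> nat \<Rightarrow> 'a set \<Rightarrow> bool" where
  "good U C k Q \<longleftrightarrow> real (bad_extensions E U \<theta> C k Q) < r ^ k"

text \<open>The reservoir \<open>C\<close> was chosen inside the set \<open>U\<close> of vertices unused before block \<open>j - 1\<close> was
  embedded; it serves the vertices of \<open>B\<close> in block \<open>j\<close>.\<close>

definition state :: "nat \<Rightarrow> ('b \<Rightarrow> 'a) \<Rightarrow> 'a set \<Rightarrow> 'a set \<Rightarrow> bool" where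
  "state j g U C \<longleftrightarrow> inj_on g (below j) \<and> g ` below j \<subseteq> V \<and>
     (\<forall>y \<in> B \<inter> below j. \<forall>x \<in> N y. (g x, g y) \<in> E) \<and>
     C \<subseteq> U \<and> U \<subseteq> V \<and> \<alpha> ^ (2 * \<Delta> + 1) * real (card V) / 2 \<le> real (card C) \<and>
     good U C \<Delta> {} \<and> card (U \<inter> g ` below j) \<le> 2 * M \<and>
     (\<forall>y \<in> B. lev y = j \<longrightarrow> good U C (\<Delta> - card (N y \<inter> below j)) (g ` (N y \<inter> below j)))"

lemma finite_below: "finite (below j)"
  using finA finB by (simp add: below_def)

lemma cardV: "0 < card V"
proof (rule ccontr)
  assume "\<not> 0 < card V"
  then show False using M_le \<Delta>0 M0 by (simp add: mult_le_0_iff)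
qed

lemma \<alpha>_le_1: "\<alpha> \<le> 1"
proof -
  obtain v where "v \<in> V" using cardV by (metis card.empty ex_in_conv less_numeral_extra(3))
  then have "\<alpha> * real (card V) \<le> real (card (common_nbrs E V {v}))" using min_degree by fastforce
  also have "\<dots> \<le> 1 * real (card V)"
    using finV by (simp add: card_mono common_nbrs_subset)
  finally show ?thesis using cardV by (simp del: mult_1)
qed

lemma M_le_power:
  assumes "k \<le> 6 * \<Delta> + 1"
  shows "128 * real \<Delta> * real M \<le> \<alpha> ^ k * real (card V)"
proof -
  have "\<alpha> ^ (6 * \<Delta> + 1) \<le> \<alpha> ^ k"
    using assms \<alpha>0 \<alpha>_le_1 by (intro power_decreasing) auto
  then have "\<alpha> ^ (6 * \<Delta> + 1) * real (card V) \<le> \<alpha> ^ k * real (card V)"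
    by (rule mult_right_mono) simp
  then show ?thesis using M_le by linarith
qed

lemma M_le_power_weak:
  assumes "k \<le> 6 * \<Delta> + 1"
  shows "128 * real M \<le> \<alpha> ^ k * real (card V)"
proof -
  have "128 * real M * 1 \<le> 128 * real M * real \<Delta>"
    using \<Delta>0 by (intro mult_left_mono) auto
  then show ?thesis using M_le_power[OF assms] by (simp add: mult_ac)
qed

lemma \<xi>_pos: "0 < \<xi>" and r_pos: "0 < r" and \<theta>_pos: "0 < \<theta>"
  using \<alpha>0 cardV \<Delta>0 M0 by (simp_all add: \<xi>_def r_def \<theta>_def)

lemma \<Delta>_r: "real \<Delta> * r = \<xi> / 2"
  using \<Delta>0 by (simp add: r_def)

text \<open>Supplies the size condition of \<open>many_common_nbrs\<close>.\<close>

lemma r_less_card_C: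
  assumes "\<alpha> ^ (2 * \<Delta> + 1) * real (card V) / 2 \<le> real (card C)"
  shows "r < real (card C)"
proof -
  have "r \<le> \<xi> / 2"
    using \<xi>_pos \<Delta>0 by (simp add: r_def field_simps)
  also have "\<dots> < \<xi>" using \<xi>_pos by simp
  also have "\<xi> \<le> \<alpha> ^ (2 * \<Delta> + 1) * real (card V) / 2"
  proof -
    have "\<alpha> ^ (4 * \<Delta> + 1) \<le> \<alpha> ^ (2 * \<Delta> + 1)"
      using \<alpha>0 \<alpha>_le_1 by (intro power_decreasing) auto
    then have "\<alpha> ^ (4 * \<Delta> + 1) * real (card V) \<le> \<alpha> ^ (2 * \<Delta> + 1) * real (card V)"
      by (rule mult_right_mono) simp
    moreover have "0 \<le> \<alpha> ^ (2 * \<Delta> + 1) * real (card V)" using \<alpha>0 by simp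
    ultimately show ?thesis unfolding \<xi>_def by linarith
  qed
  finally show ?thesis using assms by linarith
qed

section \<open>Reservoirs and the passage from one block to the next\<close>

lemma choose_reservoir:
  assumes "U \<subseteq> V" and "W \<subseteq> U" and "W \<noteq> {}" and "card (V - U) \<le> card A + card B"
  obtains C where "C \<subseteq> U" and "\<alpha> ^ (2 * \<Delta>) / 2 * real (card W) \<le> real (card (C \<inter> W))"
    and "\<alpha> ^ (2 * \<Delta> + 1) * real (card V) / 2 \<le> real (card C)" and "good U C \<Delta> {}"
proof -
  define d where "d = \<alpha> * real (card V)"
  have d0: "0 < d" using \<alpha>0 cardV by (simp add: d_def)
  have finU: "finite U" using assms finV finite_subset by blast
  have U0: "0 < card U" using assms finU by (auto simp: card_gt_0_iff)
  have Un: "card U \<le> card V" using assms finV by (simp add: card_mono)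
  have deg: "d \<le> real (card (common_nbrs E U {u}))" if "u \<in> U" for u
  proof -
    have "common_nbrs E V {u} \<subseteq> common_nbrs E U {u} \<union> (V - U)"
      by (auto simp: common_nbrs_def)
    then have "card (common_nbrs E V {u}) \<le> card (common_nbrs E U {u}) + card (V - U)"
      by (rule card_subset_Un_le) (use finV finU in \<open>auto simp: finite_common_nbrs\<close>)
    then show ?thesis using min_degree[of u] that assms by (auto simp: d_def)
  qed
  have dU: "d \<le> real (card U)"
  proof -
    obtain u where "u \<in> U" using assms by auto
    then show ?thesis
      using deg[of u] card_mono[OF finU common_nbrs_subset[of E U "{u}"]] by linarith
  qed
  obtain C where C: "C \<subseteq> U" "(d / real (card U)) ^ (2 * \<Delta>) / 2 * real (card W) \<le> real (card (C \<inter> W))"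
    "(d / real (card U)) ^ (2 * \<Delta>) / 2 * real (card U) \<le> real (card C)"
    "real (bad_extensions E U \<theta> C \<Delta> {}) < (2 * \<theta> * (real (card U))\<^sup>2 / d\<^sup>2) ^ \<Delta>"
    using dependent_random_choice[OF finU symE assms(2,3) d0 \<theta>_pos \<Delta>0 deg] by blast
  have "\<alpha> \<le> d / real (card U)"
    using U0 Un \<alpha>0 by (simp add: d_def field_simps)
  then have pw: "\<alpha> ^ (2 * \<Delta>) \<le> (d / real (card U)) ^ (2 * \<Delta>)"
    using \<alpha>0 by (intro power_mono) auto
  have "\<alpha> ^ (2 * \<Delta>) / 2 * real (card W) \<le> (d / real (card U)) ^ (2 * \<Delta>) / 2 * real (card W)"
    using pw by (intro mult_right_mono) auto
  then have 1: "\<alpha> ^ (2 * \<Delta>) / 2 * real (card W) \<le> real (card (C \<inter> W))" using C by linarith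
  have "\<alpha> ^ (2 * \<Delta>) / 2 * d \<le> (d / real (card U)) ^ (2 * \<Delta>) / 2 * real (card U)"
    using pw dU d0 \<alpha>0 by (intro mult_mono) auto
  then have 2: "\<alpha> ^ (2 * \<Delta> + 1) * real (card V) / 2 \<le> real (card C)"
    using C by (simp add: d_def mult_ac)
  \<comment> \<open>As \<open>card U \<le> card V\<close>, it suffices that \<theta> is at most half
    of \<open>r\<close> times the square of \<alpha>; with denominators cleared this is the bound on
    \<open>M\<close> with constant 128. The exponent \<open>4 * \<Delta> + 3\<close> is admissible
    because \<Delta> is at least 1.\<close>
  have "2 * \<theta> * (real (card U))\<^sup>2 / d\<^sup>2 \<le> r"
  proof -
    have "16 * real \<Delta> * (8 * real M) \<le> \<alpha> ^ (4 * \<Delta> + 3) * real (card V)"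
      using M_le_power[of "4 * \<Delta> + 3"] \<Delta>0 by simp
    then have "2 * \<theta> \<le> r * \<alpha>\<^sup>2"
      using \<Delta>0 by (simp add: \<theta>_def r_def \<xi>_def field_simps power_add power2_eq_square power3_eq_cube)
    then have "(2 * \<theta>) * (real (card U))\<^sup>2 \<le> (r * \<alpha>\<^sup>2) * (real (card V))\<^sup>2"
      by (rule mult_mono) (use Un r_pos in \<open>auto intro: power_mono\<close>)
    then have "2 * \<theta> * (real (card U))\<^sup>2 \<le> r * d\<^sup>2"
      by (simp add: d_def power_mult_distrib)
    then show ?thesis using d0 by (simp add: divide_le_eq)
  qed
  then have "(2 * \<theta> * (real (card U))\<^sup>2 / d\<^sup>2) ^ \<Delta> \<le> r ^ \<Delta>"
    using \<theta>_pos by (intro power_mono) auto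
  then have "good U C \<Delta> {}" using C by (simp add: good_def)
  then show thesis using that C(1) 1 2 by blast
qed

lemma state_0: "\<exists>g U C. state 0 g U C"
proof -
  have "V \<noteq> {}" using cardV by auto
  then obtain C where "C \<subseteq> V" "\<alpha> ^ (2 * \<Delta> + 1) * real (card V) / 2 \<le> real (card C)" "good V C \<Delta> {}"
    using choose_reservoir[of V V] by auto
  \<comment> \<open>Nothing lies below level 0, so the map is arbitrary and goodness is only asked
    of the empty set.\<close>
  then have "state 0 (\<lambda>_. undefined) V C"
    by (auto simp: state_def below_def)
  then show ?thesis by blast
qed

text \<open>Placing \<open>Aj\<close> in both the old and the new reservoir serves two levels of
  \<open>B\<close>: level \<open>j\<close> completes its neighbourhoods in \<open>C\<close>, and
  level \<open>Suc j\<close> starts its own in \<open>C'\<close>.\<close>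

lemma state_Suc:
  assumes "state j g Up C"
  shows "\<exists>g U C. state (Suc j) g U C"
proof -
  from assms have inj: "inj_on g (below j)" and im: "g ` below j \<subseteq> V"
    and arcs: "\<And>x y. y \<in> B \<Longrightarrow> y \<in> below j \<Longrightarrow> x \<in> N y \<Longrightarrow> (g x, g y) \<in> E"
    and CU: "C \<subseteq> Up" and UV: "Up \<subseteq> V"
    and cC: "\<alpha> ^ (2 * \<Delta> + 1) * real (card V) / 2 \<le> real (card C)"
    and used: "card (Up \<inter> g ` below j) \<le> 2 * M"
    and goodC: "\<And>y. y \<in> B \<Longrightarrow> lev y = j \<Longrightarrow>
      good Up C (\<Delta> - card (N y \<inter> below j)) (g ` (N y \<inter> below j))"
    by (auto simp: state_def)
  \<comment> \<open>\<open>Up\<close> dates from before the preceding block, so \<open>C\<close> may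
    contain images of that block; \<open>W\<close> discards them.\<close>
  define U where "U = V - g ` below j"
  define W where "W = C \<inter> U"
  define Aj where "Aj = {x \<in> A. lev x = j}"
  define Bj where "Bj = {y \<in> B. lev y = j}"
  have finUp: "finite Up" and finC: "finite C" and finU: "finite U"
    using finV UV CU by (auto simp: U_def intro: finite_subset)
  have belowS: "below (Suc j) = below j \<union> Aj \<union> Bj"
    by (auto simp: below_def Aj_def Bj_def)

  \<comment> \<open>Losing at most \<open>2 * M\<close> vertices costs at most half of the
    guaranteed size of \<open>C\<close>.\<close>
  have cW: "\<alpha> ^ (2 * \<Delta> + 1) * real (card V) / 4 \<le> real (card W)"
  proof -
    have "C \<subseteq> W \<union> (Up \<inter> g ` below j)" using CU UV by (auto simp: W_def U_def)
    then have "card C \<le> card W + card (Up \<inter> g ` below j)"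
      by (rule card_subset_Un_le) (use finC finUp in \<open>auto simp: W_def\<close>)
    then have "real (card C) \<le> real (card W) + 2 * real M" using used by linarith
    then show ?thesis using cC M_le_power_weak[of "2 * \<Delta> + 1"] by simp
  qed
  have "W \<noteq> {}"
  proof
    assume "W = {}"
    moreover have "0 < \<alpha> ^ (2 * \<Delta> + 1) * real (card V)" using \<alpha>0 cardV by simp
    ultimately show False using cW by simp
  qed
  moreover have "card (V - U) \<le> card A + card B"
  proof -
    have "V - U \<subseteq> g ` below j" by (auto simp: U_def)
    then have "card (V - U) \<le> card (below j)"
      by (meson card_image_le card_mono finite_below finite_imageI order_trans)
    also have "\<dots> \<le> card (A \<union> B)"
      using finA finB by (intro card_mono) (auto simp: below_def)
    finally show ?thesis using card_Un_le[of A B] by linarith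
  qed
  ultimately obtain C' where C': "C' \<subseteq> U"
    "\<alpha> ^ (2 * \<Delta>) / 2 * real (card W) \<le> real (card (C' \<inter> W))"
    "\<alpha> ^ (2 * \<Delta> + 1) * real (card V) / 2 \<le> real (card C')" "good U C' \<Delta> {}"
    using choose_reservoir[of U W] by (auto simp: U_def W_def)
  define X where "X = C' \<inter> W"
  have cX: "\<xi> \<le> real (card X)"
  proof -
    have "\<xi> = \<alpha> ^ (2 * \<Delta>) / 2 * (\<alpha> ^ (2 * \<Delta> + 1) * real (card V) / 4)"
      by (simp add: \<xi>_def power_add[symmetric] mult_ac)
    also have "\<dots> \<le> \<alpha> ^ (2 * \<Delta>) / 2 * real (card W)"
      using cW \<alpha>0 by (intro mult_left_mono) auto
    finally show ?thesis using C'(2) by (simp add: X_def)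
  qed

  \<comment> \<open>By \<open>lev_N\<close>, only these two levels of \<open>B\<close> can have
    neighbours in \<open>Aj\<close>.\<close>
  define Y where "Y = {y \<in> B. lev y = j \<or> lev y = Suc j}"
  define Uy where "Uy = (\<lambda>y. if lev y = j then Up else U)"
  define Cy where "Cy = (\<lambda>y. if lev y = j then C else C')"
  have finAj: "finite Aj" "finite Bj" and Aj_disj: "below j \<inter> Aj = {}"
    using finA finB by (auto simp: Aj_def Bj_def below_def)
  have finC': "finite C'" using C'(1) finU finite_subset by blast
  have bigX: "real (card Aj) + real \<Delta> * r \<le> real (card X)"
  proof -
    have "real (card Aj) \<le> real M" using card_A_level[of j] by (simp add: Aj_def)
    moreover have "real M \<le> \<xi> / 2" using M_le_power_weak[of "4 * \<Delta> + 1"] by (simp add: \<xi>_def)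
    ultimately show ?thesis using cX \<Delta>_r by linarith
  qed
  have degY: "card {y \<in> Y. x \<in> N y} \<le> \<Delta>" if "x \<in> Aj" for x
  proof -
    have "card {y \<in> Y. x \<in> N y} \<le> card {y \<in> B. x \<in> N y}"
      using finB by (intro card_mono) (auto simp: Y_def)
    then show ?thesis using card_N_conv[of x] that by (simp add: Aj_def)
  qed
  have NY: "finite (N y) \<and> card (N y) \<le> \<Delta>" if "y \<in> Y" for y
    using that N_subset[of y] card_N[of y] finA finite_subset by (auto simp: Y_def)
  have goodY: "real (bad_extensions E (Uy y) \<theta> (Cy y) (\<Delta> - card (N y \<inter> below j))
      (g ` (N y \<inter> below j))) < r ^ (\<Delta> - card (N y \<inter> below j))" if "y \<in> Y" for y
  proof (cases "lev y = j")
    case True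
    then show ?thesis using goodC[of y] that by (simp add: Y_def Uy_def Cy_def good_def)
  next
    case False
    \<comment> \<open>A vertex on level \<open>Suc j\<close> has no neighbour before block
      \<open>j\<close>, so its count starts from the empty set.\<close>
    then have "N y \<inter> below j = {}" using that lev_N[of y] by (fastforce simp: Y_def below_def)
    then show ?thesis using C'(4) False by (simp add: Uy_def Cy_def good_def)
  qed
  obtain h where h_eq: "\<And>x. x \<in> below j \<Longrightarrow> h x = g x" and h_inj: "inj_on h (below j \<union> Aj)"
    and h_X: "h ` Aj \<subseteq> X"
    and h_good: "\<And>y. y \<in> Y \<Longrightarrow> real (bad_extensions E (Uy y) \<theta> (Cy y)
           (\<Delta> - card (N y \<inter> (below j \<union> Aj))) (h ` (N y \<inter> (below j \<union> Aj))))
             < r ^ (\<Delta> - card (N y \<inter> (below j \<union> Aj)))"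
    by (rule greedy_embedding_good[where g = g and X = X and Y = Y and N = N and \<Delta> = \<Delta>
          and r = r and Uy = Uy and Cy = Cy and \<theta> = \<theta> and E = E and ?D0.0 = "below j" and ?D1.0 = Aj])
      (use finAj finite_below Aj_disj finC finC' finB r_pos inj NY degY goodY bigX in
        \<open>auto simp: X_def W_def U_def Y_def Cy_def\<close>)

  have N_below: "N y \<subseteq> below j \<union> Aj" if "y \<in> Bj" for y
    using that N_subset[of y] lev_N[of y] by (fastforce simp: Bj_def below_def Aj_def)
  \<comment> \<open>All neighbours of \<open>y\<close> are placed now, so goodness yields
    \<open>4 * M\<close> common neighbours; at most \<open>3 * M\<close> points of \<open>Up\<close>
    are used and \<open>Bj\<close> needs at most \<open>M\<close> more.\<close>
  have big: "card (Up \<inter> h ` (below j \<union> Aj)) + card Bj \<le> card (common_nbrs E Up (h ` N y))"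
    if "y \<in> Bj" for y
  proof -
    have "N y \<inter> (below j \<union> Aj) = N y" using N_below[OF that] by auto
    then have "real (bad_extensions E Up \<theta> C (\<Delta> - card (N y)) (h ` N y)) < r ^ (\<Delta> - card (N y))"
      using h_good[of y] that by (simp add: Y_def Bj_def Uy_def Cy_def)
    then have "\<theta> \<le> real (card (common_nbrs E Up (h ` N y)))"
      using many_common_nbrs[OF finUp finC r_pos r_less_card_C[OF cC]] by blast
    moreover have "Up \<inter> h ` (below j \<union> Aj) \<subseteq> (Up \<inter> g ` below j) \<union> h ` Aj"
      using h_eq by auto
    then have "card (Up \<inter> h ` (below j \<union> Aj)) \<le> card (Up \<inter> g ` below j) + card (h ` Aj)"
      by (rule card_subset_Un_le) (use finUp finAj in auto)
    moreover have "card (h ` Aj) \<le> card Aj"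
      using finAj by (simp add: card_image_le)
    moreover have "card Aj \<le> M" "card Bj \<le> M"
      using card_A_level card_B_level by (simp_all add: Aj_def Bj_def)
    ultimately show ?thesis using used by (simp add: \<theta>_def)
  qed
  have Bj_disj: "(below j \<union> Aj) \<inter> Bj = {}"
    using AB by (auto simp: Aj_def Bj_def below_def)
  obtain k where k_eq: "\<And>x. x \<in> below j \<union> Aj \<Longrightarrow> k x = h x" and k_inj: "inj_on k (below j \<union> Aj \<union> Bj)"
    and k_U: "k ` Bj \<subseteq> Up" and k_arc: "\<And>x y. y \<in> Bj \<Longrightarrow> x \<in> N y \<Longrightarrow> (k x, k y) \<in> E"
    using greedy_embedding_common_nbrs[where N = N and E = E,
        OF finAj(2) finite_UnI[OF finite_below finAj(1)] Bj_disj finUp h_inj N_below big]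
    by metis

  have k_g: "k ` below j = g ` below j" using k_eq h_eq by auto
  have k_Aj: "k ` Aj \<subseteq> V" using k_eq h_X by (auto simp: X_def W_def U_def)
  have k_im: "k ` (below j \<union> Aj \<union> Bj) \<subseteq> V"
    unfolding image_Un k_g using k_Aj k_U im UV by blast
  have "(k x, k y) \<in> E" if "y \<in> B" "y \<in> below (Suc j)" "x \<in> N y" for x y
  proof (cases "y \<in> Bj")
    case True
    then show ?thesis using k_arc that by blast
  next
    case False
    then have y: "y \<in> below j" using that AB by (auto simp: belowS Aj_def)
    then have "x \<in> below j"
      using that N_subset[of y] lev_N[of y x] by (auto simp: below_def)
    then show ?thesis using arcs[of y x] y that k_eq h_eq by simp
  qed
  \<comment> \<open>\<open>U\<close> avoids the images of all earlier blocks, so only block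
    \<open>j\<close> can meet it.\<close>
  moreover have "card (U \<inter> k ` below (Suc j)) \<le> 2 * M"
  proof -
    have "U \<inter> k ` below (Suc j) \<subseteq> k ` (Aj \<union> Bj)"
      using k_g by (auto simp: belowS U_def)
    then have "card (U \<inter> k ` below (Suc j)) \<le> card (Aj \<union> Bj)"
      using finAj by (meson card_image_le card_mono finite_UnI finite_imageI order_trans)
    then show ?thesis
      using card_Un_le[of Aj Bj] card_A_level[of j] card_B_level[of j] by (simp add: Aj_def Bj_def)
  qed
  moreover have "good U C' (\<Delta> - card (N y \<inter> below (Suc j))) (k ` (N y \<inter> below (Suc j)))"
    if "y \<in> B" "lev y = Suc j" for y
  proof -
    \<comment> \<open>\<open>N y\<close> lies in \<open>A\<close>, so placing \<open>Bj\<close>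
      leaves the goodness of \<open>y\<close> unchanged.\<close>
    have eq: "N y \<inter> below (Suc j) = N y \<inter> (below j \<union> Aj)"
      using N_subset[OF that(1)] AB by (auto simp: belowS Bj_def)
    have "k ` (N y \<inter> (below j \<union> Aj)) = h ` (N y \<inter> (below j \<union> Aj))"
      using k_eq by (intro image_cong) auto
    then show ?thesis
      using h_good[of y] that unfolding eq by (simp add: Y_def Uy_def Cy_def good_def)
  qed
  ultimately have "state (Suc j) k U C'"
    using k_inj k_im C' by (simp add: state_def belowS U_def)
  then show ?thesis by blast
qed

theorem embedding_exists:
  "\<exists>g. inj_on g (A \<union> B) \<and> g ` (A \<union> B) \<subseteq> V \<and> (\<forall>y\<in>B. \<forall>x\<in>N y. (g x, g y) \<in> E)"
proof -
  have "\<exists>g U C. state j g U C" for j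
    by (induction j) (use state_0 state_Suc in blast)+
  \<comment> \<open>One beyond the top level, as \<open>below\<close> is strict. If
    \<open>A \<union> B\<close> is empty, so is \<open>below\<close> at every level, whatever value
    \<open>Max\<close> takes.\<close>
  then obtain g U C where st: "state (Suc (Max (lev ` (A \<union> B)))) g U C" by blast
  have "below (Suc (Max (lev ` (A \<union> B)))) = A \<union> B"
    using finA finB by (auto simp: below_def less_Suc_eq_le intro!: Max_ge)
  then show ?thesis using st by (auto simp: state_def)
qed

end

section \<open>From the bandwidth to blocks\<close>

text \<open>The minimum is attained because some bound is admissible: in any bijective labelling,
  labels differ by at most \<open>card (pverts H)\<close>.\<close>

lemma bandwidth_labelling:
  assumes "pair_graph H"
  obtains f where "bij_betw f (pverts H) {1..card (pverts H)}"
    and "\<And>u v. (u, v) \<in> parcs H \<Longrightarrow> \<bar>int (f u) - int (f v)\<bar> \<le> int (bandwidth H)"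
proof -
  interpret pair_graph H by fact
  let ?P = "\<lambda>b. \<exists>f. bij_betw f (pverts H) {1..card (pverts H)} \<and>
     (\<forall>(u, v) \<in> parcs H. \<bar>int (f u) - int (f v)\<bar> \<le> int b)"
  obtain f where f: "bij_betw f (pverts H) {1..card (pverts H)}"
    using finite_same_card_bij[OF finite_verts, of "{1..card (pverts H)}"] by auto
  have "f v \<in> {1..card (pverts H)}" if "v \<in> pverts H" for v
    using f that by (rule bij_betw_apply)
  then have "f u \<in> {1..card (pverts H)}" "f v \<in> {1..card (pverts H)}" if "(u, v) \<in> parcs H" for u v
    using in_arcsD1[OF that] in_arcsD2[OF that] by blast+
  then have "\<bar>int (f u) - int (f v)\<bar> \<le> int (card (pverts H))" if "(u, v) \<in> parcs H" for u v
    using that by fastforce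
  then have "?P (card (pverts H))" using f by blast
  then have "?P (bandwidth H)" unfolding bandwidth_def by (rule LeastI)
  then show thesis using that by blast
qed

lemma out_degree_eq_card:
  "out_degree (with_proj G) v = card {w. (v, w) \<in> parcs G}"
proof -
  have "out_arcs (with_proj G) v = Pair v ` {w. (v, w) \<in> parcs G}"
    by (auto simp: out_arcs_def)
  then show ?thesis by (simp add: out_degree_def card_image inj_on_def)
qed

theorem theorem1p6:
  fixes \<delta> \<alpha> :: real and \<Delta> n :: nat
    and G :: "'a pair_pre_digraph" and H :: "'b pair_pre_digraph"
  assumes "\<delta> > 0" and "\<alpha> > 0" and "\<Delta> > 0"
    and "pair_graph G" and "card (pverts G) = n"
    and "\<forall>v \<in> pverts G. real (out_degree (with_proj G) v) \<ge> (\<delta> + \<alpha>) * real n"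
    and "pair_graph H" and "bipartite H"
    and "real (card (pverts H)) \<le> \<delta> * real n"
    and "\<forall>v \<in> pverts H. out_degree (with_proj H) v \<le> \<Delta>"
    and "real (bandwidth H) \<le> 1 / (256 * real \<Delta>) * \<alpha> ^ (6 * \<Delta> + 1) * real n"
  shows "contains_copy G H"
proof -
  interpret G: pair_graph G by fact
  interpret H: pair_graph H by fact
  let ?b = "bandwidth H"
  obtain f where f: "bij_betw f (pverts H) {1..card (pverts H)}"
    and fb: "\<And>u v. (u, v) \<in> parcs H \<Longrightarrow> \<bar>int (f u) - int (f v)\<bar> \<le> int ?b"
    using bandwidth_labelling[OF assms(7)] by blast
  have f_inj: "inj_on f (pverts H)" using f by (simp add: bij_betw_def)
  have f_pos: "1 \<le> f v" if "v \<in> pverts H" for v using bij_betw_apply[OF f that] by simp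
  have symG: "sym (parcs G)" and symH: "sym (parcs H)"
    using G.sym_arcs H.sym_arcs by (simp_all add: symmetric_def arcs_ends_def)
  have nbrs: "common_nbrs (parcs G) (pverts G) {v} = {w. (v, w) \<in> parcs G}" for v
    using G.in_arcsD2 by (auto simp: common_nbrs_def)
  have deg: "(\<delta> + \<alpha>) * real n \<le> real (card (common_nbrs (parcs G) (pverts G) {v}))"
    if "v \<in> pverts G" for v
    using that assms(6) by (simp add: nbrs out_degree_eq_card)
  have "\<exists>g. inj_on g (pverts H) \<and> g ` pverts H \<subseteq> pverts G \<and> (\<forall>(u, v) \<in> parcs H. (g u, g v) \<in> parcs G)"
  \<comment> \<open>Blocks of length \<open>2 * ?b\<close> need positive bandwidth. With bandwidth 0
    there are no arcs and any injection will do; it exists because a degree of at least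
    \<open>(\<delta> + \<alpha>) * n\<close> forces \<open>\<delta> * n \<le> n\<close>.\<close>
  proof (cases "?b = 0")
    case True
    have no_arcs: "parcs H = {}"
    proof (rule equals0I, clarify)
      fix u v assume uv: "(u, v) \<in> parcs H"
      then have "f u = f v" using fb[OF uv] True by simp
      then have "u = v" using f_inj H.in_arcsD1[OF uv] H.in_arcsD2[OF uv] by (auto dest: inj_onD)
      then show False using H.no_loops'[OF uv] by simp
    qed
    have "card (pverts H) \<le> card (pverts G)"
    proof (cases "pverts G = {}")
      case True
      then show ?thesis using assms(5,9) by simp
    next
      case False
      then obtain v where "v \<in> pverts G" by auto
      then have "(\<delta> + \<alpha>) * real n \<le> real n"
        using deg[of v] card_mono[OF G.finite_verts common_nbrs_subset[of "parcs G" "pverts G" "{v}"]]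
          assms(5) by simp
      moreover have "\<delta> * real n \<le> (\<delta> + \<alpha>) * real n" using assms(2) by (intro mult_right_mono) auto
      ultimately show ?thesis using assms(5,9) by linarith
    qed
    from card_le_inj[OF H.finite_verts G.finite_verts this]
    obtain g where "g ` pverts H \<subseteq> pverts G" "inj_on g (pverts H)"
      by (elim exE conjE)
    then show ?thesis by (intro exI[of _ g]) (simp add: no_arcs)
  next
    case False
    obtain A B where H_AB: "A \<union> B = pverts H" "A \<inter> B = {}"
      and parts: "\<forall>(u, v)\<in>parcs H. (u \<in> A \<and> v \<in> B) \<or> (u \<in> B \<and> v \<in> A)"
      using assms(8) unfolding bipartite_def by (elim exE conjE)
    have bip: "(u \<in> A \<and> v \<in> B) \<or> (u \<in> B \<and> v \<in> A)" if "(u, v) \<in> parcs H" for u v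
      using bspec[OF parts that] by simp
    have fin: "finite A" "finite B" using H_AB(1) H.finite_verts by (metis finite_Un)+
    define N where "N = (\<lambda>y. {x. (y, x) \<in> parcs H})"
    \<comment> \<open>Shifting the blocks of \<open>B\<close> by the bandwidth makes the neighbours of a vertex of \<open>B\<close> meet only
      two blocks of \<open>A\<close>, although blocks have length only twice the bandwidth.\<close>
    define lev where "lev = (\<lambda>x. (f x - 1 + (if x \<in> B then ?b else 0)) div (2 * ?b))"
    have level: "card {x \<in> S. lev x = j} \<le> 2 * ?b" if S: "S = A \<or> S = B" for S j
    proof -
      \<comment> \<open>The shift is constant on each class, so \<open>F\<close> is injective there
        and maps a level into an interval of length \<open>2 * ?b\<close>.\<close>
      define c where "c = (if S = B then ?b else 0)"
      define F where "F = (\<lambda>x. f x - 1 + c)"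
      have SH: "S \<subseteq> pverts H" using S H_AB by auto
      have lev_F: "lev x = F x div (2 * ?b)" if "x \<in> S" for x
        using that S H_AB(2) by (auto simp: lev_def F_def c_def)
      have "inj_on F {x \<in> S. lev x = j}"
      proof (rule inj_onI)
        fix x y assume xy: "x \<in> {x \<in> S. lev x = j}" "y \<in> {x \<in> S. lev x = j}" "F x = F y"
        then have "x \<in> pverts H" "y \<in> pverts H" using SH by auto
        moreover from this have "f x = f y" using xy(3) f_pos[of x] f_pos[of y] by (simp add: F_def)
        ultimately show "x = y" using f_inj by (auto dest: inj_onD)
      qed
      moreover have "F ` {x \<in> S. lev x = j} \<subseteq> {j * (2 * ?b)..<j * (2 * ?b) + 2 * ?b}"
      proof clarify
        fix x assume "x \<in> S" "j = lev x"
        then have "lev x * (2 * ?b) + F x mod (2 * ?b) = F x"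
          by (simp only: lev_F div_mult_mod_eq)
        moreover have "F x mod (2 * ?b) < 2 * ?b" using False by simp
        ultimately show "F x \<in> {lev x * (2 * ?b)..<lev x * (2 * ?b) + 2 * ?b}"
          unfolding atLeastLessThan_iff by linarith
      qed
      ultimately have "card {x \<in> S. lev x = j} \<le> card {j * (2 * ?b)..<j * (2 * ?b) + 2 * ?b}"
        by (intro card_inj_on_le) auto
      then show ?thesis by simp
    qed
    have "block_embedding (pverts G) (parcs G) A B N lev \<Delta> (2 * ?b) \<alpha>"
    proof
      fix v assume "v \<in> pverts G"
      moreover have "card A + card B = card (pverts H)"
        using H_AB fin by (metis card_Un_disjoint)
      ultimately show "\<alpha> * real (card (pverts G)) + real (card A + card B)
          \<le> real (card (common_nbrs (parcs G) (pverts G) {v}))"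
        using deg[of v] assms(5,9) by (simp add: algebra_simps)
    next
      fix y assume y: "y \<in> B"
      show "N y \<subseteq> A" using bip y H_AB(2) by (auto simp: N_def)
      show "card (N y) \<le> \<Delta>" using assms(10) y H_AB by (auto simp: N_def out_degree_eq_card)
      fix x assume x: "x \<in> N y"
      then have arc: "(y, x) \<in> parcs H" by (simp add: N_def)
      have "x \<in> A" using bip[OF arc] y H_AB(2) by auto
      then have xB: "x \<notin> B" using H_AB(2) by auto
      \<comment> \<open>With labels counted from 0, \<open>p \<le> q + ?b \<le> p + 2 * ?b\<close>,
        so the quotients differ by at most one.\<close>
      define p q where "p = f x - 1" and "q = f y - 1"
      have pq: "p \<le> q + ?b" "q \<le> p + ?b"
        using fb[OF arc] f_pos[of x] f_pos[of y] \<open>x \<in> A\<close> y H_AB(1) by (auto simp: p_def q_def)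
      have lev_xy: "lev x = p div (2 * ?b)" "lev y = (q + ?b) div (2 * ?b)"
        using xB y by (simp_all add: lev_def p_def q_def)
      have "lev x \<le> lev y" unfolding lev_xy using pq by (intro div_le_mono)
      moreover have "lev y \<le> (p + 2 * ?b) div (2 * ?b)"
        unfolding lev_xy using pq by (intro div_le_mono) simp
      then have "lev y \<le> Suc (lev x)" unfolding lev_xy using False by simp
      ultimately show "lev x = lev y \<or> Suc (lev x) = lev y" by linarith
    next
      fix x assume x: "x \<in> A"
      have "{y \<in> B. x \<in> N y} \<subseteq> {y. (x, y) \<in> parcs H}" using symH by (auto simp: N_def dest: symD)
      moreover have "finite {y. (x, y) \<in> parcs H}"
        by (rule finite_subset[OF _ H.finite_verts]) (auto dest: H.in_arcsD2)
      ultimately have "card {y \<in> B. x \<in> N y} \<le> card {y. (x, y) \<in> parcs H}" by (intro card_mono)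
      then show "card {y \<in> B. x \<in> N y} \<le> \<Delta>"
        using assms(10) x H_AB by (force simp: out_degree_eq_card)
    next
      \<comment> \<open>Each class has at most \<open>2 * ?b\<close> vertices per block, which turns
        the constant 256 into 128.\<close>
      show "128 * real \<Delta> * real (2 * ?b) \<le> \<alpha> ^ (6 * \<Delta> + 1) * real (card (pverts G))"
        using assms(3,5,11) by (simp add: field_simps)
    qed (use fin H_AB(2) assms(2,3) False symG level in auto)
    then interpret block_embedding "pverts G" "parcs G" A B N lev \<Delta> "2 * ?b" \<alpha> .
    obtain g where g: "inj_on g (A \<union> B)" "g ` (A \<union> B) \<subseteq> pverts G"
      "\<And>x y. y \<in> B \<Longrightarrow> x \<in> N y \<Longrightarrow> (g x, g y) \<in> parcs G"
      using embedding_exists by blast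
    \<comment> \<open>The block embedding handles arcs from \<open>A\<close> to \<open>B\<close>;
      symmetry of both graphs gives the reverse ones.\<close>
    have "(g u, g v) \<in> parcs G" if "(u, v) \<in> parcs H" for u v
    proof -
      have "(v, u) \<in> parcs H" using symH that by (rule symD)
      then show ?thesis using bip[OF that] g(3)[of v u] g(3)[of u v] that symG
        by (auto simp: N_def dest: symD)
    qed
    then show ?thesis using g(1,2) unfolding H_AB(1) by (intro exI[of _ g]) auto
  qed
  then show ?thesis using contains_copy_iff[OF assms(4,7)] by simp
qed

end
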